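(* For an integer $k\ge 2$, let $n(k)$ denote the minimum number of vertices of an asymmetric $k$-graph having at least two vertices. Then $n(2)=6$, $n(3)=6$, and $n(k)=k+2$ for every integer $k\ge 4$.
   Context: A $k$-graph (or $k$-uniform hypergraph) is a pair $(X,\mathscr{M})$ where $X$ is a finite set (the vertices) and $\mathscr{M}\subseteq\binom{X}{k}=\{A\subseteq X: |A|=k\}$ (the edges). An automorphism of $(X,\mathscr{M})$ is a bijection $\phi:X\to X$ such that, for every $A\subseteq X$ with $|A|=k$, $A\in\mathscr{M}$ if and only if $\phi(A)\in\mathscr{M}$. A $k$-graph is asymmetric if its only automorphism is the identity; otherwise it is symmetric. *)

theory Defs
  imports Complex_Main
begin

definition k_graph :: "nat \<Rightarrow> 'a set \<Rightarrow> 'a set set \<Rightarrow> bool" where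
  "k_graph k X M \<longleftrightarrow> finite X \<and> M \<subseteq> {A. A \<subseteq> X \<and> card A = k}"

text \<open>An automorphism is a total function of which only the restriction to \<open>X\<close> matters;
  accordingly, being the identity is only required on \<open>X\<close> below.\<close>

definition automorphism :: "nat \<Rightarrow> 'a set \<Rightarrow> 'a set set \<Rightarrow> ('a \<Rightarrow> 'a) \<Rightarrow> bool" where
  "automorphism k X M \<phi> \<longleftrightarrow>
     bij_betw \<phi> X X \<and> (\<forall>A. A \<subseteq> X \<and> card A = k \<longrightarrow> (A \<in> M \<longleftrightarrow> \<phi> ` A \<in> M))"

definition asymmetric :: "nat \<Rightarrow> 'a set \<Rightarrow> 'a set set \<Rightarrow> bool" where
  "asymmetric k X M \<longleftrightarrow>
     k_graph k X M \<and> (\<forall>\<phi>. automorphism k X M \<phi> \<longrightarrow> (\<forall>x\<in>X. \<phi> x = x))"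

text \<open>Vertices are natural numbers. No order is lost, because every asymmetric \<open>k\<close>-graph
  over any type has an asymmetric copy on natural numbers (\<open>card_in_asymmetric_orders\<close>).\<close>

definition asymmetric_orders :: "nat \<Rightarrow> nat set" where
  "asymmetric_orders k =
     {card X | (X :: nat set) (M :: nat set set). asymmetric k X M \<and> card X \<ge> 2}"

text \<open>A relation rather than \<open>Inf (asymmetric_orders k)\<close>, because on \<^typ>\<open>nat\<close> the value
  \<open>Inf {}\<close> is unspecified: here it is part of the claim that the minimum is attained.
  Such an \<open>m\<close> is unique by antisymmetry.\<close>

definition is_min_asymmetric_order :: "nat \<Rightarrow> nat \<Rightarrow> bool" where
  "is_min_asymmetric_order k m \<longleftrightarrow>
     m \<in> asymmetric_orders k \<and> (\<forall>n\<in>asymmetric_orders k. m \<le> n)"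

lemma asymmetric_image:
  fixes f :: "'a \<Rightarrow> 'b"
  assumes as: "asymmetric k X M" and inj: "inj_on f X"
  shows "asymmetric k (f ` X) ((`) f ` M)"
proof -
  have fin: "finite X" and M: "\<And>A. A \<in> M \<Longrightarrow> A \<subseteq> X \<and> card A = k"
    using as by (auto simp: asymmetric_def k_graph_def)
  have mem: "f ` A \<in> (`) f ` M \<longleftrightarrow> A \<in> M" if "A \<subseteq> X" for A
    using that M inj_on_image_eq_iff[OF inj] by (auto simp: image_iff)
  have cardf: "card (f ` A) = card A" if "A \<subseteq> X" for A
    using card_image inj_on_subset[OF inj that] by blast
  have kg: "k_graph k (f ` X) ((`) f ` M)"
    using fin M cardf by (fastforce simp: k_graph_def)
  have "\<psi> y = y" if aut: "automorphism k (f ` X) ((`) f ` M) \<psi>" and y: "y \<in> f ` X" for \<psi> y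
  proof -
    define g where "g = inv_into X f"
    define \<phi> where "\<phi> = g \<circ> (\<psi> \<circ> f)"
    have bf: "bij_betw f X (f ` X)" using inj by (simp add: inj_on_imp_bij_betw)
    have bp: "bij_betw \<psi> (f ` X) (f ` X)" using aut by (simp add: automorphism_def)
    have bg: "bij_betw g (f ` X) X" unfolding g_def by (rule bij_betw_inv_into[OF bf])
    have b: "bij_betw \<phi> X X"
      unfolding \<phi>_def by (intro bij_betw_trans[OF bij_betw_trans[OF bf bp] bg])
    have f\<phi>: "f (\<phi> x) = \<psi> (f x)" if "x \<in> X" for x
    proof -
      have "\<psi> (f x) \<in> f ` X" using bp that by (auto simp: bij_betw_def)
      then show ?thesis by (simp add: \<phi>_def g_def f_inv_into_f)
    qed
    have "A \<in> M \<longleftrightarrow> \<phi> ` A \<in> M" if A: "A \<subseteq> X" "card A = k" for A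
    proof -
      have sub: "\<phi> ` A \<subseteq> X" using b A by (auto simp: bij_betw_def)
      have im: "f ` (\<phi> ` A) = \<psi> ` (f ` A)"
        unfolding image_image using A f\<phi> by (intro image_cong) auto
      have "A \<in> M \<longleftrightarrow> f ` A \<in> (`) f ` M" using mem[OF A(1)] by simp
      also have "\<dots> \<longleftrightarrow> \<psi> ` (f ` A) \<in> (`) f ` M"
        using aut A cardf[OF A(1)] image_mono[OF A(1), of f] by (simp add: automorphism_def)
      also have "\<dots> \<longleftrightarrow> \<phi> ` A \<in> M" using mem[OF sub] im by simp
      finally show ?thesis .
    qed
    with b have "automorphism k X M \<phi>" by (auto simp: automorphism_def)
    with as have fixed: "\<phi> x = x" if "x \<in> X" for x using that by (auto simp: asymmetric_def)
    from y obtain x where "x \<in> X" "y = f x" by auto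
    with f\<phi>[of x] fixed[of x] show ?thesis by simp
  qed
  with kg show ?thesis by (auto simp: asymmetric_def)
qed

lemma card_in_asymmetric_orders:
  fixes X :: "'a set"
  assumes "asymmetric k X M" and "card X \<ge> 2"
  shows "card X \<in> asymmetric_orders k"
proof -
  have "finite X" using assms by (simp add: asymmetric_def k_graph_def)
  then obtain f :: "'a \<Rightarrow> nat" where f: "inj_on f X"
    using finite_imp_inj_to_nat_seg by blast
  have "card (f ` X) = card X" using f by (rule card_image)
  with asymmetric_image[OF assms(1) f] assms(2) show ?thesis
    unfolding asymmetric_orders_def by (smt (verit) mem_Collect_eq)
qed

end

theory Submission
  imports Defs "HOL-Combinatorics.Transposition"
begin

text \<open>
  Complementing every edge inside the vertex set turns an asymmetric \<open>k\<close>-graph on \<open>n\<close> vertices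
  into an asymmetric \<open>(n - k)\<close>-graph on the same vertices (\<open>asymmetric_Compl_vertices\<close>). On \<open>k + 1\<close>
  vertices this leaves a \<open>1\<close>-graph, that is, a partition of at least three vertices into two
  classes, and exchanging two vertices of one class is a symmetry; on at most \<open>k\<close> vertices
  everything can be permuted. So every asymmetric \<open>k\<close>-graph with \<open>k \<ge> 2\<close> has at least \<open>k + 2\<close>
  vertices (\<open>asymmetric_card_ge\<close>). On \<open>k + 2\<close> vertices the complementary objects are ordinary
  graphs, so all depends on which numbers of vertices admit an asymmetric graph.

  That set of numbers is closed upwards: an asymmetric graph without isolated vertices stays
  asymmetric when an isolated vertex is added, and a graph with an isolated vertex can be replaced
  by its complement (\<open>asymmetric_add_vertex\<close>). Two finite facts therefore settle the graph case.
  Every graph on five vertices has an automorphism of order two (\<open>no_asymmetric_graph_5\<close>), whence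
  there is no asymmetric graph on four vertices either; and there is an asymmetric graph on
  six vertices, whose vertices are told apart by an invariant built from the degrees
  (\<open>asymmetric_graph_6\<close>). This gives \<open>n(2) = 6\<close>, and \<open>n(k) = k + 2\<close> as soon
  as \<open>k + 2 \<ge> 6\<close>.

  For \<open>k = 3\<close> the order \<open>k + 2 = 5\<close> is excluded by the graphs on five vertices, and a \<open>3\<close>-graph on
  six vertices whose vertex degrees are all different shows that \<open>6\<close> is attained
  (\<open>asymmetric_3_graph_6\<close>).
\<close>

section \<open>Automorphisms and complements\<close>

lemma automorphism_bij_edges:
  assumes "k_graph k X M" and "automorphism k X M \<phi>"
  shows "bij_betw ((`) \<phi>) M M"
proof -
  have fin: "finite X" and M: "M \<subseteq> Pow X"
    using assms(1) by (auto simp: k_graph_def)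
  have "inj_on \<phi> X" using assms(2) by (simp add: automorphism_def bij_betw_def)
  then have inj: "inj_on ((`) \<phi>) M"
    using inj_on_image_Pow inj_on_subset M by blast
  have "\<phi> ` A \<in> M" if "A \<in> M" for A
    using assms that unfolding automorphism_def k_graph_def by blast
  then have "(`) \<phi> ` M \<subseteq> M" by blast
  moreover have "finite M" using fin M finite_subset by blast
  ultimately show ?thesis using inj by (simp add: bij_betw_def endo_inj_surj)
qed

text \<open>A bijection of \<open>X\<close> maps the complement of \<open>A\<close> to the complement of the image of \<open>A\<close>, so
  the two hypergraphs have the same automorphisms.\<close>

lemma asymmetric_Compl_vertices:
  assumes as: "asymmetric k X M" and le: "k \<le> card X"
  shows "asymmetric (card X - k) X ((-) X ` M)"
proof -
  have fin: "finite X" and M: "\<And>A. A \<in> M \<Longrightarrow> A \<subseteq> X \<and> card A = k"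
    using as by (auto simp: asymmetric_def k_graph_def)
  have mem: "X - A \<in> (-) X ` M \<longleftrightarrow> A \<in> M" if "A \<subseteq> X" for A
    using that M by (auto simp: image_iff) (metis double_diff subset_refl)
  have kg: "k_graph (card X - k) X ((-) X ` M)"
    using fin M by (auto simp: k_graph_def) (metis card_Diff_subset finite_subset)
  have "automorphism k X M \<phi>" if aut: "automorphism (card X - k) X ((-) X ` M) \<phi>" for \<phi>
  proof -
    have b: "bij_betw \<phi> X X" using aut by (simp add: automorphism_def)
    have "A \<in> M \<longleftrightarrow> \<phi> ` A \<in> M" if A: "A \<subseteq> X" "card A = k" for A
    proof -
      have "\<phi> ` (X - A) = X - \<phi> ` A"
        using b A(1) inj_on_image_set_diff[of \<phi> X X A] by (simp add: bij_betw_def)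
      moreover have "card (X - A) = card X - k"
        using A fin by (metis card_Diff_subset finite_subset)
      ultimately have "X - A \<in> (-) X ` M \<longleftrightarrow> X - \<phi> ` A \<in> (-) X ` M"
        using aut by (metis Diff_subset automorphism_def)
      moreover have "\<phi> ` A \<subseteq> X" using b A(1) by (auto simp: bij_betw_def)
      ultimately show ?thesis using mem A(1) by blast
    qed
    with b show ?thesis by (simp add: automorphism_def)
  qed
  with kg as show ?thesis by (auto simp: asymmetric_def)
qed

lemma asymmetric_Compl_edges:
  assumes as: "asymmetric k X M"
  shows "asymmetric k X ({A. A \<subseteq> X \<and> card A = k} - M)"
proof -
  have "automorphism k X M \<phi>"
    if aut: "automorphism k X ({A. A \<subseteq> X \<and> card A = k} - M) \<phi>" for \<phi>
  proof -
    have b: "bij_betw \<phi> X X" using aut by (simp add: automorphism_def)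
    have "A \<in> M \<longleftrightarrow> \<phi> ` A \<in> M" if A: "A \<subseteq> X" "card A = k" for A
    proof -
      have "\<phi> ` A \<subseteq> X" "card (\<phi> ` A) = k"
        using A b by (metis bij_betw_def card_image image_mono inj_on_subset)+
      with aut A show ?thesis unfolding automorphism_def by blast
    qed
    with b show ?thesis by (simp add: automorphism_def)
  qed
  with as show ?thesis by (auto simp: asymmetric_def k_graph_def)
qed

section \<open>The lower bound\<close>

text \<open>Otherwise exchanging \<open>x\<close> and \<open>y\<close> would be an automorphism: edges containing both or neither
  of them are mapped to themselves.\<close>

lemma asymmetric_no_twins:
  assumes as: "asymmetric k X M" and xy: "x \<in> X" "y \<in> X" "x \<noteq> y"
  shows "\<exists>B \<subseteq> X - {x, y}. Suc (card B) = k \<and> (insert x B \<in> M \<longleftrightarrow> insert y B \<notin> M)"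
proof (rule ccontr)
  assume "\<not> ?thesis"
  then have twins: "insert x B \<in> M \<longleftrightarrow> insert y B \<in> M"
    if "B \<subseteq> X - {x, y}" "Suc (card B) = k" for B
    using that by blast
  have fin: "finite X" using as by (simp add: asymmetric_def k_graph_def)
  let ?t = "transpose x y"
  have swap: "?t ` insert u B = insert v B"
    if "{u, v} = {x, y}" "B \<subseteq> X - {x, y}" for u v B
    using that xy(3) by (auto simp: doubleton_eq_iff transpose_def image_iff)
  have "A \<in> M \<longleftrightarrow> ?t ` A \<in> M" if A: "A \<subseteq> X" "card A = k" for A
  proof (cases "x \<in> A \<longleftrightarrow> y \<in> A")
    case True
    then show ?thesis by simp
  next
    case False
    then obtain u v where uv: "{u, v} = {x, y}" "u \<in> A" "v \<notin> A" by blast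
    define B where "B = A - {u}"
    have A_eq: "A = insert u B" and B: "B \<subseteq> X - {x, y}" using uv A by (auto simp: B_def)
    have "Suc (card B) = k"
      using A uv(2) fin card_Suc_Diff1 finite_subset unfolding B_def by metis
    then have "insert x B \<in> M \<longleftrightarrow> insert y B \<in> M" using twins B by blast
    then show ?thesis
      using uv(1) unfolding A_eq swap[OF uv(1) B] by (auto simp: doubleton_eq_iff)
  qed
  moreover have "bij_betw ?t X X" using xy by (simp add: bij_betw_transpose_iff)
  ultimately have "automorphism k X M ?t" by (simp add: automorphism_def)
  with as xy show False by (metis asymmetric_def transpose_apply_first)
qed

text \<open>The set \<open>B\<close> of \<open>k - 1\<close> further vertices that separates two vertices already forces
  \<open>k + 1\<close> vertices. With exactly \<open>k + 1\<close> the complementary \<open>1\<close>-graph must tell any two of at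
  least three vertices apart, which two classes cannot do.\<close>

lemma asymmetric_card_ge:
  assumes as: "asymmetric k X M" and k: "2 \<le> k" and X: "2 \<le> card X"
  shows "k + 2 \<le> card X"
proof -
  have fin: "finite X" using as by (simp add: asymmetric_def k_graph_def)
  have "k + 1 \<le> card X"
  proof -
    obtain x y where xy: "x \<in> X" "y \<in> X" "x \<noteq> y"
      using X fin by (metis card_2_iff' obtain_subset_with_card_n subset_iff)
    then obtain B where B: "B \<subseteq> X - {x, y}" "Suc (card B) = k"
      using asymmetric_no_twins[OF as] by blast
    have "card B \<le> card (X - {x, y})" using B(1) fin by (simp add: card_mono)
    also have "\<dots> = card X - 2" using xy fin by (simp add: card_Diff_subset)
    finally show ?thesis using B(2) X by linarith
  qed
  moreover have "card X \<noteq> k + 1"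
  proof
    assume n: "card X = k + 1"
    define N where "N = (-) X ` M"
    have as1: "asymmetric 1 X N"
      using asymmetric_Compl_vertices[OF as] n by (simp add: N_def)
    have sep: "{x} \<in> N \<longleftrightarrow> {y} \<notin> N" if xy: "x \<in> X" "y \<in> X" "x \<noteq> y" for x y
    proof -
      obtain B where "B \<subseteq> X - {x, y}" "card B = 0" "insert x B \<in> N \<longleftrightarrow> insert y B \<notin> N"
        using asymmetric_no_twins[OF as1 xy] by auto
      moreover from this have "B = {}" using fin by (metis card_0_eq finite_Diff finite_subset)
      ultimately show ?thesis by simp
    qed
    \<comment> \<open>Two of any three vertices agree on being an edge of the \<open>1\<close>-graph.\<close>
    obtain T where "T \<subseteq> X" "card T = 3"
      using obtain_subset_with_card_n[of 3 X] n k by auto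
    then obtain x y z where "x \<in> X" "y \<in> X" "z \<in> X" "x \<noteq> y" "y \<noteq> z" "x \<noteq> z"
      by (auto simp: card_3_iff)
    then show False using sep by blast
  qed
  ultimately show ?thesis by linarith
qed

section \<open>Adding a vertex\<close>

text \<open>If every old vertex lies in an edge, then the new vertex is the only isolated one, so it is
  fixed by all automorphisms, which therefore restrict to the old vertices.\<close>

lemma asymmetric_insert_isolated:
  assumes as: "asymmetric k X M" and v: "v \<notin> X" and cover: "X \<subseteq> \<Union>M"
  shows "asymmetric k (insert v X) M"
proof -
  have M: "\<And>A. A \<in> M \<Longrightarrow> A \<subseteq> X" and kg: "k_graph k (insert v X) M"
    using as by (auto simp: asymmetric_def k_graph_def)
  have "\<phi> x = x" if aut: "automorphism k (insert v X) M \<phi>" and x: "x \<in> insert v X" for \<phi> x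
  proof -
    have b: "bij_betw \<phi> (insert v X) (insert v X)" using aut by (simp add: automorphism_def)
    have \<phi>v: "\<phi> v = v"
    proof (rule ccontr)
      assume "\<phi> v \<noteq> v"
      then have "\<phi> v \<in> X" using b by (auto simp: bij_betw_def)
      then obtain A where A: "A \<in> M" "\<phi> v \<in> A" using cover by auto
      moreover have "(`) \<phi> ` M = M"
        using automorphism_bij_edges[OF kg aut] by (simp add: bij_betw_def)
      ultimately obtain B where B: "B \<in> M" "A = \<phi> ` B" by blast
      then obtain w where w: "w \<in> B" "\<phi> v = \<phi> w" using A(2) by auto
      then have "v = w" using b M[OF B(1)] by (auto simp: bij_betw_def inj_on_def)
      then show False using v w(1) M[OF B(1)] by blast
    qed
    have "bij_betw \<phi> X X"
      using bij_betw_DiffI[OF b, of "{v}" "{v}"] \<phi>v v by simp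
    then have "automorphism k X M \<phi>" using aut by (auto simp: automorphism_def)
    then show ?thesis using as x \<phi>v by (auto simp: asymmetric_def)
  qed
  with kg show ?thesis by (auto simp: asymmetric_def)
qed

text \<open>If some vertex \<open>u\<close> is isolated, then passing to the complement makes every \<open>k\<close>-set
  through \<open>u\<close> an edge, and these cover all vertices.\<close>

lemma asymmetric_add_vertex:
  assumes as: "asymmetric k X M" and k: "2 \<le> k" "k \<le> card X" and v: "v \<notin> X"
  shows "\<exists>M'. asymmetric k (insert v X) M'"
proof (cases "X \<subseteq> \<Union>M")
  case True
  then show ?thesis using asymmetric_insert_isolated[OF as v] by blast
next
  case False
  then obtain u where u: "u \<in> X" "\<And>A. A \<in> M \<Longrightarrow> u \<notin> A" by blast
  define N where "N = {A. A \<subseteq> X \<and> card A = k} - M"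
  have fin: "finite X" using as by (simp add: asymmetric_def k_graph_def)
  have "X \<subseteq> \<Union>N"
  proof
    fix x assume x: "x \<in> X"
    have "card {u, x} \<le> k" using k(1) by (simp add: card_insert_if)
    moreover have "{u, x} \<subseteq> X" using u(1) x by simp
    ultimately obtain A where A: "{u, x} \<subseteq> A" "A \<subseteq> X" "card A = k"
      using exists_subset_between[OF _ k(2) _ fin] by blast
    then have "A \<in> N" using u(2) by (auto simp: N_def)
    then show "x \<in> \<Union>N" using A(1) by blast
  qed
  then show ?thesis
    using asymmetric_insert_isolated[OF _ v] asymmetric_Compl_edges[OF as]
    unfolding N_def by blast
qed

section \<open>Graphs on five vertices\<close>

text \<open>Otherwise the permutation \<open>(x y)(z w)\<close> would be an automorphism: it maps the pairs \<open>{x, y}\<close>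
  and \<open>{z, w}\<close> to themselves and exchanges the other eight as listed.\<close>

lemma asymmetric_no_double_transposition:
  assumes as: "asymmetric 2 X M" and X: "X = {x, y, z, w, v}" and dist: "distinct [x, y, z, w, v]"
  shows "\<not> (({x, z} \<in> M \<longleftrightarrow> {y, w} \<in> M) \<and> ({x, w} \<in> M \<longleftrightarrow> {y, z} \<in> M) \<and>
            ({x, v} \<in> M \<longleftrightarrow> {y, v} \<in> M) \<and> ({z, v} \<in> M \<longleftrightarrow> {w, v} \<in> M))"
proof
  assume eqs: "({x, z} \<in> M \<longleftrightarrow> {y, w} \<in> M) \<and> ({x, w} \<in> M \<longleftrightarrow> {y, z} \<in> M) \<and>
            ({x, v} \<in> M \<longleftrightarrow> {y, v} \<in> M) \<and> ({z, v} \<in> M \<longleftrightarrow> {w, v} \<in> M)"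
  define \<phi> where "\<phi> = id(x := y, y := x, z := w, w := z)"
  have \<phi>: "\<phi> x = y" "\<phi> y = x" "\<phi> z = w" "\<phi> w = z" "\<phi> v = v"
    using dist by (auto simp: \<phi>_def)
  have "bij_betw \<phi> X X"
    by (rule bij_betw_byWitness[where f' = \<phi>]) (auto simp: X \<phi>)
  moreover have "A \<in> M \<longleftrightarrow> \<phi> ` A \<in> M" if A: "A \<subseteq> X" "card A = 2" for A
  proof -
    let ?P = "{(x, y), (x, z), (x, w), (x, v), (y, z), (y, w), (y, v), (z, w), (z, v), (w, v)}"
    obtain p q where A_eq: "A = {p, q}" and "(p, q) \<in> ?P"
    proof -
      obtain p q where pq: "A = {p, q}" "p \<noteq> q" using A(2) by (auto simp: card_2_iff)
      then have "p \<in> {x, y, z, w, v}" "q \<in> {x, y, z, w, v}" using A(1) X by auto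
      then have "(p, q) \<in> ?P \<or> (q, p) \<in> ?P"
        using pq(2) by (elim insertE emptyE) simp_all
      then show thesis using that[of p q] that[of q p] pq(1) insert_commute[of p q] by metis
    qed
    then have "{p, q} \<in> M \<longleftrightarrow> {\<phi> p, \<phi> q} \<in> M"
      unfolding insert_iff prod.inject empty_iff simp_thms
      by (elim disjE conjE; hypsubst; simp only: \<phi> eqs insert_commute[of y x] insert_commute[of w z])
    then show ?thesis by (simp add: A_eq)
  qed
  ultimately have "automorphism 2 X M \<phi>" by (simp add: automorphism_def)
  then have "\<phi> x = x" using as X by (simp add: asymmetric_def)
  then show False using \<phi>(1) dist by auto
qed

text \<open>For every choice of the ten adjacencies, one of the ten transpositions or fifteen double
  transpositions preserves them. Thus the conditions excluding these 25 permutations, read as propositional formulas with one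
  variable per pair of vertices, are jointly unsatisfiable.\<close>

lemma no_asymmetric_graph_5:
  assumes X: "card X = 5"
  shows "\<not> asymmetric 2 X M"
proof
  assume as: "asymmetric 2 X M"
  obtain a b c d e where X_eq: "X = {a, b, c, d, e}" and dist: "distinct [a, b, c, d, e]"
  proof -
    have "finite X" using X card.infinite by fastforce
    then obtain xs where xs: "set xs = X" "distinct xs"
      using finite_distinct_list by blast
    then have "length xs = 5" using X distinct_card by fastforce
    then obtain a b c d e where "xs = [a, b, c, d, e]"
      by (auto simp: length_Suc_conv numeral_eq_Suc)
    with xs that show thesis by auto
  qed
  define E where "E x y \<longleftrightarrow> {x, y} \<in> M" for x y
  have E_commute: "E x y \<longleftrightarrow> E y x" for x y by (simp add: E_def insert_commute)
  have X_perm: "X = {x, y, z, w, v}"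
    if "{x, y, z, w, v} \<subseteq> X" "distinct [x, y, z, w, v]" for x y z w v
    using that distinct_card[of "[x, y, z, w, v]"] X card_subset_eq[of X "{x, y, z, w, v}"]
    by (simp add: card_ge_0_finite)
  have ndt: "\<not> ((E x z \<longleftrightarrow> E y w) \<and> (E x w \<longleftrightarrow> E y z) \<and> (E x v \<longleftrightarrow> E y v) \<and> (E z v \<longleftrightarrow> E w v))"
    if "{x, y, z, w, v} \<subseteq> X" "distinct [x, y, z, w, v]" for x y z w v
    using asymmetric_no_double_transposition[OF as X_perm[OF that] that(2)] by (simp add: E_def)
  have nt: "\<not> ((E x z \<longleftrightarrow> E y z) \<and> (E x w \<longleftrightarrow> E y w) \<and> (E x v \<longleftrightarrow> E y v))"
    if Xd: "{x, y, z, w, v} \<subseteq> X" "distinct [x, y, z, w, v]" for x y z w v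
  proof -
    obtain B where B: "B \<subseteq> X - {x, y}" "card B = 1" "insert x B \<in> M \<longleftrightarrow> insert y B \<notin> M"
      using asymmetric_no_twins[OF as, of x y] Xd by auto
    then obtain t where "B = {t}" by (auto simp: card_1_singleton_iff)
    then show ?thesis using B X_perm[OF Xd] by (auto simp: E_def)
  qed
  \<comment> \<open>These orient every pair alphabetically, leaving ten propositional variables.\<close>
  note E_sym = E_commute[of b a] E_commute[of c a] E_commute[of d a] E_commute[of e a]
    E_commute[of c b] E_commute[of d b] E_commute[of e b] E_commute[of d c] E_commute[of e c]
    E_commute[of e d]
  note transpositions =
    nt[of a b c d e] nt[of a c b d e] nt[of a d b c e] nt[of a e b c d]
    nt[of b c a d e] nt[of b d a c e] nt[of b e a c d] nt[of c d a b e]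
    nt[of c e a b d] nt[of d e a b c]
  note double_transpositions =
    ndt[of b c d e a] ndt[of b d c e a] ndt[of b e c d a] ndt[of a c d e b]
    ndt[of a d c e b] ndt[of a e c d b] ndt[of a b d e c] ndt[of a d b e c]
    ndt[of a e b d c] ndt[of a b c e d] ndt[of a c b e d] ndt[of a e b c d]
    ndt[of a b c d e] ndt[of a c b d e] ndt[of a d b c e]
  have mem: "a \<in> X" "b \<in> X" "c \<in> X" "d \<in> X" "e \<in> X" by (simp_all add: X_eq)
  have neq: "a \<noteq> b" "a \<noteq> c" "a \<noteq> d" "a \<noteq> e" "b \<noteq> c" "b \<noteq> d" "b \<noteq> e" "c \<noteq> d" "c \<noteq> e" "d \<noteq> e"
    using dist by auto
  show False
    using transpositions double_transpositions
    by (simp (no_asm_use) only: mem neq neq[symmetric] E_sym distinct.simps list.set insert_iff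
        empty_iff insert_subset empty_subsetI simp_thms True_implies_equals) sat
qed

section \<open>Invariants of vertices\<close>

text \<open>Summing a vertex function over the edges at each vertex. For the constant \<open>1\<close> on a
  \<open>k\<close>-graph this is \<open>k\<close> times the degree; on graphs it is the signless Laplacian.\<close>

definition edge_sum :: "'a set set \<Rightarrow> ('a \<Rightarrow> nat) \<Rightarrow> 'a \<Rightarrow> nat" where
  "edge_sum M w x = (\<Sum>A\<in>M. if x \<in> A then sum w A else 0)"

text \<open>An automorphism permutes the edges and carries those at \<open>x\<close> to those at \<open>\<phi> x\<close>. The lemma
  applies to its own conclusion, so invariants can be iterated.\<close>

lemma edge_sum_invariant:
  assumes kg: "k_graph k X M" and aut: "automorphism k X M \<phi>"
    and w: "\<And>x. x \<in> X \<Longrightarrow> w (\<phi> x) = w x" and x: "x \<in> X"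
  shows "edge_sum M w (\<phi> x) = edge_sum M w x"
proof -
  have inj: "inj_on \<phi> X" using aut by (simp add: automorphism_def bij_betw_def)
  have "edge_sum M w (\<phi> x) = (\<Sum>A\<in>M. if \<phi> x \<in> \<phi> ` A then sum w (\<phi> ` A) else 0)"
    unfolding edge_sum_def
    by (rule sum.reindex_bij_betw[OF automorphism_bij_edges[OF kg aut], symmetric])
  also have "\<dots> = edge_sum M w x"
    unfolding edge_sum_def
  proof (rule sum.cong[OF refl])
    fix A assume "A \<in> M"
    then have A: "A \<subseteq> X" using kg by (auto simp: k_graph_def)
    then have "sum w (\<phi> ` A) = sum w A"
      using inj_on_subset[OF inj A] w by (simp add: sum.reindex subset_iff)
    then show "(if \<phi> x \<in> \<phi> ` A then sum w (\<phi> ` A) else 0) = (if x \<in> A then sum w A else 0)"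
      using inj_on_image_mem_iff[OF inj x A] by simp
  qed
  finally show ?thesis .
qed

text \<open>An automorphism cannot move a vertex to another one if an invariant separates all vertices.\<close>

lemma asymmetricI_invariant:
  assumes kg: "k_graph k X M" and inj: "inj_on w X"
    and inv: "\<And>\<phi> x. automorphism k X M \<phi> \<Longrightarrow> x \<in> X \<Longrightarrow> w (\<phi> x) = w x"
  shows "asymmetric k X M"
proof -
  have "\<phi> x = x" if "automorphism k X M \<phi>" "x \<in> X" for \<phi> x
  proof -
    have "\<phi> x \<in> X" using that by (auto simp: automorphism_def bij_betw_def)
    then show ?thesis using inj_onD[OF inj inv[OF that]] that(2) by blast
  qed
  with kg show ?thesis by (simp add: asymmetric_def)
qed

section \<open>Asymmetric examples on six vertices\<close>

text \<open>A triangle \<open>1, 2, 3\<close> with the pendant edge \<open>0 1\<close> and the tail \<open>3 4 5\<close>. The degrees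
  \<open>1, 3, 2, 3, 2, 1\<close> do not separate the vertices, but the second iterate of \<open>edge_sum\<close> does.\<close>

lemma asymmetric_graph_6:
  "asymmetric 2 {..<6::nat} {{0, 1}, {1, 2}, {2, 3}, {1, 3}, {3, 4}, {4, 5}}"
  (is "asymmetric 2 ?X ?M")
proof (rule asymmetricI_invariant)
  show kg: "k_graph 2 ?X ?M" by (auto simp: k_graph_def)
  have sum_eq: "edge_sum ?M w x =
      (if x \<in> {0, 1} then w 0 + w 1 else 0) + (if x \<in> {1, 2} then w 1 + w 2 else 0) +
      (if x \<in> {2, 3} then w 2 + w 3 else 0) + (if x \<in> {1, 3} then w 1 + w 3 else 0) +
      (if x \<in> {3, 4} then w 3 + w 4 else 0) + (if x \<in> {4, 5} then w 4 + w 5 else 0)" for w x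
    by (simp add: edge_sum_def doubleton_eq_iff)
  have "?X = {0, 1, 2, 3, 4, 5}" by auto
  then show "inj_on (edge_sum ?M (edge_sum ?M (\<lambda>_. 1))) ?X"
    by (simp add: sum_eq del: One_nat_def)
  show "edge_sum ?M (edge_sum ?M (\<lambda>_. 1)) (\<phi> x) = edge_sum ?M (edge_sum ?M (\<lambda>_. 1)) x"
    if "automorphism 2 ?X ?M \<phi>" "x \<in> ?X" for \<phi> x
    by (intro edge_sum_invariant[OF kg that(1)] that(2) refl)
qed

text \<open>The vertices \<open>0, \<dots>, 5\<close> have the degrees \<open>1, \<dots>, 6\<close>, so the degree alone separates them,
  which is impossible for graphs.\<close>

lemma asymmetric_3_graph_6:
  "asymmetric 3 {..<6::nat}
     {{0, 4, 5}, {1, 3, 5}, {1, 4, 5}, {2, 3, 4}, {2, 3, 5}, {2, 4, 5}, {3, 4, 5}}"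
  (is "asymmetric 3 ?X ?M")
proof (rule asymmetricI_invariant)
  show kg: "k_graph 3 ?X ?M" by (auto simp: k_graph_def)
  have sum_eq: "edge_sum ?M (\<lambda>_. 1) x =
      (\<Sum>A\<leftarrow>[{0, 4, 5}, {1, 3, 5}, {1, 4, 5}, {2, 3, 4}, {2, 3, 5}, {2, 4, 5}, {3, 4, 5}].
        if x \<in> A then 3 else 0)" for x
    by (simp add: edge_sum_def set_eq_subset)
  have "?X = {0, 1, 2, 3, 4, 5}" by auto
  then show "inj_on (edge_sum ?M (\<lambda>_. 1)) ?X"
    by (simp add: sum_eq del: One_nat_def)
  show "edge_sum ?M (\<lambda>_. 1) (\<phi> x) = edge_sum ?M (\<lambda>_. 1) x"
    if "automorphism 3 ?X ?M \<phi>" "x \<in> ?X" for \<phi> x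
    by (intro edge_sum_invariant[OF kg that(1)] that(2) refl)
qed

lemma asymmetric_graph_exists:
  fixes n :: nat
  assumes "6 \<le> n"
  shows "\<exists>M. asymmetric 2 {..<n} M"
  using assms
proof (induction n rule: dec_induct)
  case base
  show ?case using asymmetric_graph_6 by blast
next
  case (step n)
  then obtain M where "asymmetric 2 {..<n} M" by blast
  then show ?case
    using asymmetric_add_vertex[of 2 "{..<n}" M n] step.hyps by (simp add: lessThan_Suc)
qed

section \<open>The minimum orders\<close>

lemma asymmetric_graph_card_ge:
  assumes as: "asymmetric 2 X M" and X: "2 \<le> card X"
  shows "6 \<le> card (X :: nat set)"
proof -
  have fin: "finite X" using as by (simp add: asymmetric_def k_graph_def)
  have "card X \<noteq> 4"
  proof
    assume X4: "card X = 4"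
    obtain v where v: "v \<notin> X" using fin ex_new_if_finite infinite_UNIV_nat by blast
    then obtain M' where "asymmetric 2 (insert v X) M'"
      using asymmetric_add_vertex[OF as] X4 by auto
    moreover have "card (insert v X) = 5" using X4 v fin by simp
    ultimately show False using no_asymmetric_graph_5 by blast
  qed
  moreover have "card X \<noteq> 5" using no_asymmetric_graph_5 as by blast
  ultimately show ?thesis using asymmetric_card_ge[OF as] X by linarith
qed

lemma asymmetric_3_graph_card_ge:
  assumes as: "asymmetric 3 X M" and X: "2 \<le> card X"
  shows "6 \<le> card X"
proof -
  have "card X \<noteq> 5"
    using asymmetric_Compl_vertices[OF as] no_asymmetric_graph_5 by fastforce
  then show ?thesis using asymmetric_card_ge[OF as] X by linarith
qed

lemma is_min_asymmetric_orderI: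
  assumes "asymmetric k {..<m} M" and "2 \<le> m"
    and "\<And>X M. asymmetric k X M \<Longrightarrow> 2 \<le> card (X :: nat set) \<Longrightarrow> m \<le> card X"
  shows "is_min_asymmetric_order k m"
  using assms card_in_asymmetric_orders[OF assms(1)]
  by (auto simp: is_min_asymmetric_order_def asymmetric_orders_def)

theorem theorem2:
  shows "is_min_asymmetric_order 2 6 \<and> is_min_asymmetric_order 3 6 \<and>
    (\<forall>k\<ge>4. is_min_asymmetric_order k (k + 2))"
proof (intro conjI allI impI)
  show "is_min_asymmetric_order 2 6"
    by (rule is_min_asymmetric_orderI[OF asymmetric_graph_6])
       (auto intro: asymmetric_graph_card_ge)
  show "is_min_asymmetric_order 3 6"
    by (rule is_min_asymmetric_orderI[OF asymmetric_3_graph_6])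
       (auto intro: asymmetric_3_graph_card_ge)
  show "is_min_asymmetric_order k (k + 2)" if k: "4 \<le> k" for k
  proof -
    obtain M where "asymmetric 2 {..<k + 2} M"
      using asymmetric_graph_exists[of "k + 2"] k by auto
    then have "asymmetric k {..<k + 2} ((-) {..<k + 2} ` M)"
      using asymmetric_Compl_vertices by fastforce
    then show ?thesis
      by (rule is_min_asymmetric_orderI) (use k in \<open>auto dest: asymmetric_card_ge\<close>)
  qed
qed

end
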